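(* Let $d, n \geq 1$ be integers and let $V$ be a random $d \times n$ real matrix whose entries are independent random variables, each having a probability density that is symmetric about $0$ (the distributions of different entries need not be identical). Let $X = \{Vr : r \in \{0,1\}^n\} \subseteq \mathbb{R}^d$. Then \[ \mathbb{E}_V\, p(X) \;\geq\; \frac{1}{2^{d-1}} \sum_{k=0}^{d-1} \binom{n-1}{k}. \]
   Context: For $a, b \in \mathbb{R}^d$, $b$ dominates $a$ (written $b \succ a$) if $b_i \geq a_i$ for all $i \in [d]$ and $b_i > a_i$ for at least one $i$. For a finite set $X \subseteq \mathbb{R}^d$, a point $x \in X$ is Pareto-optimal (maximal) if no $y \in X$ dominates $x$, and $p(X)$ denotes the number of Pareto-optimal points of $X$. *)

theory Defs
  imports "HOL-Probability.Probability"
begin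

text \<open>Points of R^d are represented as functions nat => real; only coordinates i < d matter
  (all points we build are 0 outside {..<d}).\<close>

definition dominates :: "nat \<Rightarrow> (nat \<Rightarrow> real) \<Rightarrow> (nat \<Rightarrow> real) \<Rightarrow> bool" where
  "dominates d b a \<longleftrightarrow> (\<forall>i<d. a i \<le> b i) \<and> (\<exists>i<d. a i < b i)"

definition pareto_optimal :: "nat \<Rightarrow> (nat \<Rightarrow> real) set \<Rightarrow> (nat \<Rightarrow> real) \<Rightarrow> bool" where
  "pareto_optimal d X x \<longleftrightarrow> x \<in> X \<and> \<not> (\<exists>y\<in>X. dominates d y x)"

definition num_pareto :: "nat \<Rightarrow> (nat \<Rightarrow> real) set \<Rightarrow> nat" where
  "num_pareto d X = card {x. pareto_optimal d X x}"

text \<open>The point set X = {V r : r in {0,1}^n}; r is identified with its support S.\<close>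
definition cube_image :: "nat \<Rightarrow> nat \<Rightarrow> (nat \<Rightarrow> nat \<Rightarrow> real) \<Rightarrow> (nat \<Rightarrow> real) set" where
  "cube_image d n V = (\<lambda>S. \<lambda>i. if i < d then (\<Sum>j\<in>S. V i j) else 0) ` Pow {..<n}"

end

theory Submission
  imports Defs "Jordan_Normal_Form.Determinant"
begin

text \<open>
  Call \<open>P \<subseteq> {..<n}\<close> a chamber of \<open>V\<close> if it is the set of columns on which some linear functional
  \<open>c\<close>, vanishing on no column, is positive. If \<open>c \<ge> 0\<close>, then \<open>P\<close> is the unique maximizer of \<open>c\<close> over
  the cube and so gives a Pareto-optimal point. Flipping the signs of the rows with \<open>c i < 0\<close> makes
  \<open>c\<close> nonnegative, so the Pareto counts of the \<open>2 ^ d\<close> row flips of \<open>V\<close> add up to at least the number of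
  chambers; by symmetry and independence every flip has the same expected count. Almost surely the
  columns are in general position, and then there are at least \<open>2 * (\<Sum>k<d. (n - 1) choose k)\<close>
  chambers: every \<open>S \<subseteq> {..<n - 1}\<close> with \<open>card S < d\<close> is strongly shattered by the chambers containing
  \<open>n - 1\<close>, i.e. all subsets of \<open>S\<close> occur in them with one common trace outside \<open>S\<close> (perturb a
  functional that vanishes on \<open>S\<close>), a family has at least as many members as
  strongly shattered sets, and \<open>c \<mapsto> - c\<close> doubles the count.
\<close>

section \<open>Strongly shattered sets\<close>

text \<open>Lower half of the sandwich theorem for shattering. The ground set grows by one element
  \<open>x\<close>, and \<open>F\<close> splits into \<open>F0\<close> and \<open>F1\<close>, whose
  union and intersection have sizes adding up to \<open>card F\<close>. Strongly shattered sets
  avoiding \<open>x\<close> are charged to the union; those containing \<open>x\<close>, after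
  deleting it, to the intersection.\<close>

lemma card_strongly_shattered_le:
  assumes "finite U" "F \<subseteq> Pow U"
  shows "card {S. S \<subseteq> U \<and> (\<exists>A. \<forall>B\<subseteq>S. A \<inter> S = {} \<and> A \<union> B \<in> F)} \<le> card F"
  using assms
proof (induction U arbitrary: F rule: finite_induct)
  case empty
  have "{S. S \<subseteq> {} \<and> (\<exists>A. \<forall>B\<subseteq>S. A \<inter> S = {} \<and> A \<union> B \<in> F)} = F"
    using empty by (fastforce simp: subset_singleton_iff)
  then show ?case by simp
next
  case (insert x U)
  define sh where "sh = (\<lambda>U F. {S::'a set. S \<subseteq> U \<and> (\<exists>A. \<forall>B\<subseteq>S. A \<inter> S = {} \<and> A \<union> B \<in> F)})"
  define F0 where "F0 = {P \<in> F. x \<notin> P}"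
  define F1 where "F1 = (\<lambda>P. P - {x}) ` {P \<in> F. x \<in> P}"
  have finF: "finite F"
    using insert.prems insert.hyps(1) by (meson finite_Pow_iff finite_insert finite_subset)
  then have fin: "finite F0" "finite F1" by (auto simp: F0_def F1_def)
  have sub: "F0 \<subseteq> Pow U" "F1 \<subseteq> Pow U"
    using insert.prems by (auto simp: F0_def F1_def)
  have cF1: "card F1 = card {P \<in> F. x \<in> P}"
    unfolding F1_def by (rule card_image) (auto simp: inj_on_def)
  have "F = F0 \<union> {P \<in> F. x \<in> P}" "F0 \<inter> {P \<in> F. x \<in> P} = {}" by (auto simp: F0_def)
  then have "card F = card F0 + card {P \<in> F. x \<in> P}"
    using finF by (metis (no_types, lifting) card_Un_disjoint finite_Un)
  then have cF: "card F = card (F0 \<union> F1) + card (F0 \<inter> F1)"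
    using card_Un_Int[OF fin] cF1 by simp
  have F1_iff: "P \<in> F1 \<longleftrightarrow> x \<notin> P \<and> insert x P \<in> F" for P
    unfolding F1_def by (auto simp: insert_absorb intro!: image_eqI[where x = "insert x P"])
  have fin_sh: "finite (sh U G)" for G
    by (rule finite_subset[of _ "Pow U"]) (use insert.hyps(1) in \<open>simp_all add: sh_def Pow_def Collect_mono\<close>)
  have "sh (insert x U) F \<subseteq> sh U (F0 \<union> F1) \<union> insert x ` sh U (F0 \<inter> F1)"
  proof
    fix S assume "S \<in> sh (insert x U) F"
    then obtain A where S: "S \<subseteq> insert x U" and A: "\<And>B. B \<subseteq> S \<Longrightarrow> A \<inter> S = {} \<and> A \<union> B \<in> F"
      unfolding sh_def by blast
    show "S \<in> sh U (F0 \<union> F1) \<union> insert x ` sh U (F0 \<inter> F1)"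
    proof (cases "x \<in> S")
      case True
      have xA: "x \<notin> A" using A[of "{}"] True by auto
      \<comment> \<open>Both \<open>B\<close> and \<open>insert x B\<close> are subsets of
        \<open>S\<close>, so \<open>A \<union> B\<close> occurs in \<open>F\<close> both with and
        without \<open>x\<close>.\<close>
      have "A \<inter> (S - {x}) = {} \<and> A \<union> B \<in> F0 \<inter> F1" if "B \<subseteq> S - {x}" for B
      proof -
        have "A \<union> B \<in> F" "A \<union> insert x B \<in> F"
          using A[of B] A[of "insert x B"] True that by auto
        then show ?thesis using A[of "{}"] xA that by (auto simp: F0_def F1_iff)
      qed
      then have "\<forall>B\<subseteq>S - {x}. A \<inter> (S - {x}) = {} \<and> A \<union> B \<in> F0 \<inter> F1" by simp
      moreover have "S - {x} \<subseteq> U" using S by auto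
      ultimately have "S - {x} \<in> sh U (F0 \<inter> F1)" unfolding sh_def mem_Collect_eq by (intro conjI exI)
      then show ?thesis using True by (auto intro!: image_eqI[where x = "S - {x}"])
    next
      case False
      \<comment> \<open>The common trace \<open>A\<close> may contain \<open>x\<close>. Then every
        \<open>A \<union> B\<close> contributes to \<open>F1\<close> once \<open>x\<close> is
        deleted; otherwise it lies in \<open>F0\<close>.\<close>
      have "(A - {x}) \<inter> S = {} \<and> (A - {x}) \<union> B \<in> F0 \<union> F1" if "B \<subseteq> S" for B
      proof -
        have "A \<union> B \<in> F" "A \<inter> S = {}" using A[OF that] by auto
        moreover have "insert x ((A - {x}) \<union> B) = A \<union> B" if "x \<in> A" using that by auto
        moreover have "(A - {x}) \<union> B = A \<union> B" if "x \<notin> A" using that by auto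
        ultimately show ?thesis using False that by (cases "x \<in> A") (auto simp: F0_def F1_iff)
      qed
      then have "\<forall>B\<subseteq>S. (A - {x}) \<inter> S = {} \<and> (A - {x}) \<union> B \<in> F0 \<union> F1" by simp
      moreover have "S \<subseteq> U" using S False by auto
      ultimately have "S \<in> sh U (F0 \<union> F1)" unfolding sh_def mem_Collect_eq by (intro conjI exI)
      then show ?thesis by simp
    qed
  qed
  then have "card (sh (insert x U) F) \<le> card (sh U (F0 \<union> F1) \<union> insert x ` sh U (F0 \<inter> F1))"
    by (rule card_mono[rotated]) (simp add: fin_sh)
  also have "\<dots> \<le> card (sh U (F0 \<union> F1)) + card (insert x ` sh U (F0 \<inter> F1))"
    by (rule card_Un_le)
  also have "card (insert x ` sh U (F0 \<inter> F1)) \<le> card (sh U (F0 \<inter> F1))"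
    by (rule card_image_le) (rule fin_sh)
  also have "card (sh U (F0 \<union> F1)) \<le> card (F0 \<union> F1)"
    unfolding sh_def by (rule insert.IH) (use sub in auto)
  also have "card (sh U (F0 \<inter> F1)) \<le> card (F0 \<inter> F1)"
    unfolding sh_def by (rule insert.IH) (use sub in auto)
  finally show ?case using cF unfolding sh_def by simp
qed

section \<open>Chambers of a matrix in general position\<close>

definition functional :: "nat \<Rightarrow> (nat \<Rightarrow> nat \<Rightarrow> real) \<Rightarrow> (nat \<Rightarrow> real) \<Rightarrow> nat \<Rightarrow> real" where
  "functional d v c j = (\<Sum>i<d. c i * v i j)"

definition pos_set :: "nat \<Rightarrow> nat \<Rightarrow> (nat \<Rightarrow> nat \<Rightarrow> real) \<Rightarrow> (nat \<Rightarrow> real) \<Rightarrow> nat set" where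
  "pos_set d n v c = {j. j < n \<and> functional d v c j > 0}"

definition generic :: "nat \<Rightarrow> nat \<Rightarrow> (nat \<Rightarrow> nat \<Rightarrow> real) \<Rightarrow> (nat \<Rightarrow> real) \<Rightarrow> bool" where
  "generic d n v c \<longleftrightarrow> (\<forall>j<n. functional d v c j \<noteq> 0)"

text \<open>These sets label the regions of the central hyperplane arrangement, in the space of
  functionals, whose normals are the columns of \<open>v\<close>.\<close>

definition chambers :: "nat \<Rightarrow> nat \<Rightarrow> (nat \<Rightarrow> nat \<Rightarrow> real) \<Rightarrow> nat set set" where
  "chambers d n v = pos_set d n v ` {c. generic d n v c}"

text \<open>Restricting to functionals supported on the first \<open>min d n\<close> rows makes every system square, also
  when \<open>n < d\<close>.\<close>

definition general_position :: "nat \<Rightarrow> nat \<Rightarrow> (nat \<Rightarrow> nat \<Rightarrow> real) \<Rightarrow> bool" where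
  "general_position d n v \<longleftrightarrow> (\<forall>T\<subseteq>{..<n}. card T = min d n \<longrightarrow>
     (\<forall>y. \<exists>c. (\<forall>i. min d n \<le> i \<longrightarrow> c i = 0) \<and> (\<forall>j\<in>T. functional d v c j = y j)) \<and>
     (\<forall>c. (\<forall>i. min d n \<le> i \<longrightarrow> c i = 0) \<and> (\<forall>j\<in>T. functional d v c j = 0) \<longrightarrow> (\<forall>i. c i = 0)))"

lemma functional_add_scaled:
  "functional d v (\<lambda>i. c i + e * w i) j = functional d v c j + e * functional d v w j"
  by (simp add: functional_def algebra_simps sum.distrib sum_distrib_left)

lemma finite_chambers: "finite (chambers d n v)"
  by (rule finite_subset[of _ "Pow {..<n}"]) (auto simp: chambers_def pos_set_def)

text \<open>Replacing \<open>c\<close> by \<open>- c\<close> complements the positive set, so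
  complementation is a bijection between the chambers containing \<open>l\<close> and those avoiding
  it.\<close>

lemma card_chambers_half:
  assumes "l < n"
  shows "card (chambers d n v) = 2 * card {P \<in> chambers d n v. l \<in> P}"
proof -
  have compl: "{..<n} - P \<in> chambers d n v" if P: "P \<in> chambers d n v" for P
  proof -
    obtain c where c: "generic d n v c" "P = pos_set d n v c"
      using P by (auto simp: chambers_def)
    have neg: "functional d v (\<lambda>i. - c i) j = - functional d v c j" for j
      by (simp add: functional_def sum_negf)
    have "generic d n v (\<lambda>i. - c i)" using c by (simp add: generic_def neg)
    moreover have "{..<n} - P = pos_set d n v (\<lambda>i. - c i)"
      using c by (force simp: pos_set_def neg generic_def)
    ultimately show ?thesis by (auto simp: chambers_def)
  qed
  have sub: "P \<subseteq> {..<n}" if "P \<in> chambers d n v" for P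
    using that by (auto simp: chambers_def pos_set_def)
  have "bij_betw (\<lambda>P. {..<n} - P) {P \<in> chambers d n v. l \<in> P} {P \<in> chambers d n v. l \<notin> P}"
    by (rule bij_betw_byWitness[where f' = "\<lambda>P. {..<n} - P"])
       (use compl sub assms in \<open>auto simp: double_diff\<close>)
  then have "card {P \<in> chambers d n v. l \<in> P} = card {P \<in> chambers d n v. l \<notin> P}"
    by (rule bij_betw_same_card)
  moreover have "card (chambers d n v)
      = card {P \<in> chambers d n v. l \<in> P} + card {P \<in> chambers d n v. l \<notin> P}"
    by (subst card_Un_disjoint[symmetric])
       (auto intro: finite_subset[OF _ finite_chambers] arg_cong[where f = card])
  ultimately show ?thesis by simp
qed

lemma card_small_subsets:
  assumes "finite U"
  shows "card {S. S \<subseteq> U \<and> card S \<le> k} = (\<Sum>i=0..k. card U choose i)"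
proof -
  have "{S. S \<subseteq> U \<and> card S \<le> k} = (\<Union>i\<in>{0..k}. {S. S \<subseteq> U \<and> card S = i})" by auto
  also have "card \<dots> = (\<Sum>i=0..k. card {S. S \<subseteq> U \<and> card S = i})"
    by (rule card_UN_disjoint) (use assms in auto)
  also have "\<dots> = (\<Sum>i=0..k. card U choose i)"
    using n_subsets[OF assms] by simp
  finally show ?thesis .
qed

text \<open>Extend \<open>S\<close> to \<open>m - 1\<close> columns \<open>T\<close> and take the
  functional \<open>c\<close> that vanishes on \<open>T\<close> and is 1 on the last column. Small
  perturbations of \<open>c\<close> realize every sign pattern on \<open>T\<close> while the signs
  off \<open>T\<close> stay fixed; the positive columns off \<open>T\<close>, without the last one,
  form the common trace \<open>A\<close>.\<close>

lemma strongly_shattered_chambers: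
  assumes gp: "general_position d n v" and "d \<ge> 1" "n \<ge> 1"
    and S: "S \<subseteq> {..<n - 1}" "card S \<le> d - 1"
  shows "\<exists>A. \<forall>B\<subseteq>S. A \<inter> S = {} \<and> insert (n - 1) (A \<union> B) \<in> chambers d n v \<and> n - 1 \<notin> A \<union> B"
proof -
  define m where "m = min d n"
  have m: "m \<ge> 1" "m - 1 \<le> n - 1" using assms by (auto simp: m_def)
  \<comment> \<open>Since \<open>S\<close> omits the last column, it has at most
    \<open>m - 1\<close> elements even when \<open>n < d\<close>.\<close>
  have "card S \<le> n - 1" using card_mono[OF _ S(1)] by simp
  then have "card S \<le> m - 1" using S(2) by (auto simp: m_def)
  then obtain T where T: "S \<subseteq> T" "T \<subseteq> {..<n - 1}" "card T = m - 1"
    using exists_subset_between[of S "m - 1" "{..<n - 1}"] S m by auto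
  have finT: "finite T" using T(2) finite_subset by blast
  have notin: "n - 1 \<notin> T" using T(2) by auto
  have extT: "insert j T \<subseteq> {..<n}" "card (insert j T) = m" if "j < n" "j \<notin> T" for j
    using T that finT m by auto
  have sol: "\<exists>c. (\<forall>i. m \<le> i \<longrightarrow> c i = 0) \<and> (\<forall>j\<in>insert (n - 1) T. functional d v c j = y j)" for y
  proof -
    have "n - 1 < n" using \<open>n \<ge> 1\<close> by simp
    then show ?thesis
      using gp extT[of "n - 1"] notin unfolding general_position_def m_def by blast
  qed
  have uniq: "\<And>c i. \<forall>i. m \<le> i \<longrightarrow> c i = 0 \<Longrightarrow> \<forall>k\<in>insert j T. functional d v c k = 0 \<Longrightarrow> c i = 0"
    if "j < n" "j \<notin> T" for j
    using gp extT[OF that] unfolding general_position_def m_def by blast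
  obtain c where c0: "\<forall>i. m \<le> i \<longrightarrow> c i = 0"
    and c: "\<forall>j\<in>insert (n - 1) T. functional d v c j = (if j = n - 1 then 1 else 0)"
    using sol[of "\<lambda>j. if j = n - 1 then 1 else 0"] by blast
  have cT: "functional d v c j = 0" if "j \<in> T" for j using c that notin by auto
  have cn: "functional d v c (n - 1) = 1" using c by auto
  \<comment> \<open>A further zero would make \<open>c\<close> vanish on \<open>m\<close> columns,
    forcing \<open>c = 0\<close> and contradicting the value 1 on the last column.\<close>
  have off: "functional d v c j \<noteq> 0" if "j < n" "j \<notin> T" for j
  proof
    assume "functional d v c j = 0"
    then have "c i = 0" for i using uniq[OF that c0] cT by blast
    then have "functional d v c (n - 1) = 0" by (simp add: functional_def)
    with cn show False by simp
  qed
  define A where "A = {j. j < n - 1 \<and> j \<notin> T \<and> functional d v c j > 0}"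
  have "A \<inter> S = {} \<and> insert (n - 1) (A \<union> B) \<in> chambers d n v \<and> n - 1 \<notin> A \<union> B" if B: "B \<subseteq> S" for B
  proof -
    \<comment> \<open>Since \<open>n - 1\<close> is not in \<open>B\<close>, \<open>w\<close> is -1
      there; this is harmless, as the sign on the last column is decided by
      \<open>c\<close>.\<close>
    obtain w where w: "\<forall>j\<in>insert (n - 1) T. functional d v w j = (if j \<in> B then 1 else -1)"
      using sol[of "\<lambda>j. if j \<in> B then 1 else -1"] by blast
    let ?c = "\<lambda>e i. c i + e * w i"
    \<comment> \<open>On \<open>T\<close> the functional \<open>c\<close> vanishes, so
      \<open>e * w\<close> decides the sign; off \<open>T\<close> the sign of \<open>c\<close>
      persists for small \<open>e\<close> by continuity.\<close>
    have ev: "eventually (\<lambda>e. sgn (functional d v (?c e) j)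
        = (if j \<in> T then if j \<in> B then 1 else - 1 else sgn (functional d v c j))) (at_right 0)" if "j < n" for j
    proof (cases "j \<in> T")
      case True
      have "eventually (\<lambda>e::real. e > 0) (at_right 0)" by (simp add: eventually_at_right_less)
      then show ?thesis
        by eventually_elim (use True w cT in \<open>auto simp: functional_add_scaled\<close>)
    next
      case False
      have lim: "((\<lambda>e. functional d v (?c e) j) \<longlongrightarrow> functional d v c j + 0 * functional d v w j) (at_right 0)"
        unfolding functional_add_scaled by (intro tendsto_intros)
      show ?thesis
      proof (cases "functional d v c j > 0")
        case True
        have "eventually (\<lambda>e. functional d v (?c e) j > 0) (at_right 0)"
          using order_tendstoD(1)[OF lim] True by simp
        then show ?thesis by eventually_elim (use True False in auto)
      next
        case neg: False
        then have neg: "functional d v c j < 0" using off[OF that False] by auto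
        have "eventually (\<lambda>e. functional d v (?c e) j < 0) (at_right 0)"
          using order_tendstoD(2)[OF lim] neg by simp
        then show ?thesis by eventually_elim (use neg False in auto)
      qed
    qed
    have "eventually (\<lambda>e. \<forall>j\<in>{..<n}. sgn (functional d v (?c e) j)
        = (if j \<in> T then if j \<in> B then 1 else - 1 else sgn (functional d v c j))) (at_right 0)"
      by (rule eventually_ball_finite) (use ev in auto)
    then obtain e where e: "\<And>j. j < n \<Longrightarrow> sgn (functional d v (?c e) j)
        = (if j \<in> T then if j \<in> B then 1 else - 1 else sgn (functional d v c j))"
      by (auto dest!: eventually_happens'[rotated])
    have gen: "generic d n v (?c e)"
      unfolding generic_def
    proof (intro allI impI notI)
      fix j assume "j < n" "functional d v (?c e) j = 0"
      then show False using e[of j] off[of j] by (auto split: if_splits simp: sgn_0_0)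
    qed
    have "functional d v (?c e) j > 0 \<longleftrightarrow> (if j \<in> T then j \<in> B else functional d v c j > 0)" if "j < n" for j
      using e[OF that] by (smt (verit) sgn_1_pos sgn_greater)
    then have "pos_set d n v (?c e) = {j. j < n \<and> (if j \<in> T then j \<in> B else functional d v c j > 0)}"
      unfolding pos_set_def by auto
    also have "\<dots> = insert (n - 1) (A \<union> B)"
      using B T notin cn \<open>n \<ge> 1\<close> by (auto simp: A_def split: if_splits)
    finally have "insert (n - 1) (A \<union> B) \<in> chambers d n v"
      using gen by (auto simp: chambers_def)
    then show ?thesis using T B by (auto simp: A_def)
  qed
  then show ?thesis by blast
qed

lemma card_chambers_ge:
  assumes gp: "general_position d n v" and "d \<ge> 1" "n \<ge> 1"
  shows "2 * (\<Sum>k=0..d - 1. (n - 1) choose k) \<le> card (chambers d n v)"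
proof -
  let ?C = "{P \<in> chambers d n v. n - 1 \<in> P}"
  \<comment> \<open>Deleting the common element moves these chambers to a ground set of size
    \<open>n - 1\<close>, the source of the upper index in the binomials.\<close>
  let ?F = "(\<lambda>P. P - {n - 1}) ` ?C"
  have sub: "P \<subseteq> {..<n}" if "P \<in> chambers d n v" for P
    using that by (auto simp: chambers_def pos_set_def)
  have FU: "?F \<subseteq> Pow {..<n - 1}" using sub by fastforce
  have "(\<Sum>k=0..d - 1. (n - 1) choose k) = card {S. S \<subseteq> {..<n - 1} \<and> card S \<le> d - 1}"
    by (simp add: card_small_subsets)
  also have "\<dots> \<le> card {S. S \<subseteq> {..<n - 1} \<and> (\<exists>A. \<forall>B\<subseteq>S. A \<inter> S = {} \<and> A \<union> B \<in> ?F)}"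
  proof (rule card_mono, simp, safe)
    fix S assume "S \<subseteq> {..<n - 1}" "card S \<le> d - 1"
    from strongly_shattered_chambers[OF assms this] obtain A where A:
      "\<And>B. B \<subseteq> S \<Longrightarrow> A \<inter> S = {} \<and> insert (n - 1) (A \<union> B) \<in> chambers d n v \<and> n - 1 \<notin> A \<union> B"
      by blast
    have "A \<inter> S = {} \<and> A \<union> B \<in> ?F" if "B \<subseteq> S" for B
      using A[OF that] by (auto intro!: image_eqI[where x = "insert (n - 1) (A \<union> B)"])
    then show "\<exists>A. \<forall>B\<subseteq>S. A \<inter> S = {} \<and> A \<union> B \<in> ?F" by blast
  qed
  also have "\<dots> \<le> card ?F"
    by (rule card_strongly_shattered_le) (use FU in auto)
  also have "\<dots> \<le> card ?C"
    by (rule card_image_le) (auto intro: finite_subset[OF _ finite_chambers])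
  finally show ?thesis using card_chambers_half[of "n - 1" n d v] \<open>n \<ge> 1\<close> by simp
qed

section \<open>Chambers and Pareto-optimal points\<close>

definition flip_rows :: "nat set \<Rightarrow> (nat \<Rightarrow> nat \<Rightarrow> real) \<Rightarrow> nat \<Rightarrow> nat \<Rightarrow> real" where
  "flip_rows s v i j = (if i \<in> s then - v i j else v i j)"

definition cube_point :: "nat \<Rightarrow> (nat \<Rightarrow> nat \<Rightarrow> real) \<Rightarrow> nat set \<Rightarrow> nat \<Rightarrow> real" where
  "cube_point d v S = (\<lambda>i. if i < d then \<Sum>j\<in>S. v i j else 0)"

lemma cube_image_eq: "cube_image d n v = cube_point d v ` Pow {..<n}"
  by (simp add: cube_image_def cube_point_def)

lemma scalar_cube_point:
  "(\<Sum>i<d. c i * cube_point d v S i) = (\<Sum>j\<in>S. functional d v c j)"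
proof -
  have "(\<Sum>i<d. c i * cube_point d v S i) = (\<Sum>i<d. \<Sum>j\<in>S. c i * v i j)"
    by (intro sum.cong) (auto simp: cube_point_def sum_distrib_left)
  also have "\<dots> = (\<Sum>j\<in>S. functional d v c j)"
    unfolding functional_def by (rule sum.swap)
  finally show ?thesis .
qed

text \<open>A vertex other than the positive set includes a column of negative value or misses one
  of positive value, and each such column costs strictly; genericity excludes columns of value
  zero.\<close>

lemma pos_set_unique_max:
  assumes "generic d n v c" "T \<subseteq> {..<n}" "T \<noteq> pos_set d n v c"
  shows "(\<Sum>i<d. c i * cube_point d v T i) < (\<Sum>i<d. c i * cube_point d v (pos_set d n v c) i)"
proof -
  let ?f = "functional d v c" and ?P = "pos_set d n v c"
  have fin: "finite T" "finite ?P" using assms(2) finite_subset by (auto simp: pos_set_def)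
  have T: "sum ?f T = sum ?f (T \<inter> ?P) + sum ?f (T - ?P)"
    using fin by (simp add: sum.Int_Diff)
  have P: "sum ?f ?P = sum ?f (T \<inter> ?P) + sum ?f (?P - T)"
    using fin by (subst sum.Int_Diff[of _ _ T]) (auto simp: Int_commute)
  have neg: "?f j < 0" if "j \<in> T - ?P" for j
    using that assms(1,2) by (auto simp: generic_def pos_set_def)
  have pos: "?f j > 0" if "j \<in> ?P - T" for j using that by (auto simp: pos_set_def)
  have "sum ?f (T - ?P) \<le> 0" using neg by (intro sum_nonpos) (auto intro: less_imp_le)
  moreover have "0 \<le> sum ?f (?P - T)" using pos by (intro sum_nonneg) (auto intro: less_imp_le)
  moreover have "sum ?f (T - ?P) < 0 \<or> 0 < sum ?f (?P - T)"
  proof (cases "T - ?P = {}")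
    case False
    then have "0 < sum (\<lambda>j. - ?f j) (T - ?P)" using neg fin by (intro sum_pos) auto
    then show ?thesis by (simp add: sum_negf)
  next
    case True
    then have "?P - T \<noteq> {}" using assms(3) by blast
    then show ?thesis using pos fin by (intro disjI2 sum_pos) auto
  qed
  ultimately show ?thesis unfolding scalar_cube_point T P by linarith
qed

text \<open>For \<open>c\<close> nonnegative, a point dominating the image of the positive set would
  have at least its \<open>c\<close>-value, against unique maximality. The same strictness makes
  distinct positive sets have distinct images.\<close>

lemma card_nonneg_chambers_le:
  "card (pos_set d n v ` {c. generic d n v c \<and> (\<forall>i<d. c i \<ge> 0)}) \<le> num_pareto d (cube_image d n v)"
proof -
  let ?Q = "pos_set d n v ` {c. generic d n v c \<and> (\<forall>i<d. c i \<ge> 0)}"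
  have Qsub: "?Q \<subseteq> Pow {..<n}" by (auto simp: pos_set_def)
  have inj: "inj_on (cube_point d v) ?Q"
  proof (rule inj_onI)
    fix P T assume P: "P \<in> ?Q" and T: "T \<in> ?Q" and eq: "cube_point d v P = cube_point d v T"
    obtain c where c: "generic d n v c" "P = pos_set d n v c" using P by auto
    have "T \<subseteq> {..<n}" using T Qsub by auto
    from pos_set_unique_max[OF c(1) this] show "P = T" using eq c(2) by auto
  qed
  have "cube_point d v ` ?Q \<subseteq> {x. pareto_optimal d (cube_image d n v) x}"
  proof clarsimp
    fix c assume c: "generic d n v c" "\<forall>i<d. 0 \<le> c i"
    let ?P = "pos_set d n v c"
    have False if T: "T \<subseteq> {..<n}" and dom: "dominates d (cube_point d v T) (cube_point d v ?P)" for T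
    proof -
      have "T \<noteq> ?P" using dom by (auto simp: dominates_def)
      then have "(\<Sum>i<d. c i * cube_point d v T i) < (\<Sum>i<d. c i * cube_point d v ?P i)"
        by (rule pos_set_unique_max[OF c(1) T])
      moreover have "(\<Sum>i<d. c i * cube_point d v ?P i) \<le> (\<Sum>i<d. c i * cube_point d v T i)"
        using dom c(2) by (intro sum_mono mult_left_mono) (auto simp: dominates_def)
      ultimately show False by simp
    qed
    moreover have "?P \<subseteq> {..<n}" by (auto simp: pos_set_def)
    ultimately show "pareto_optimal d (cube_image d n v) (cube_point d v ?P)"
      unfolding pareto_optimal_def cube_image_eq by blast
  qed
  moreover have "finite {x. pareto_optimal d (cube_image d n v) x}"
    by (rule finite_subset[of _ "cube_image d n v"]) (auto simp: pareto_optimal_def cube_image_eq)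
  ultimately have "card (cube_point d v ` ?Q) \<le> num_pareto d (cube_image d n v)"
    unfolding num_pareto_def by (intro card_mono)
  then show ?thesis by (simp add: card_image[OF inj])
qed

lemma card_chambers_le_sum_num_pareto:
  "card (chambers d n v) \<le> (\<Sum>s\<in>Pow {..<d}. num_pareto d (cube_image d n (flip_rows s v)))"
proof -
  let ?Q = "\<lambda>s. pos_set d n (flip_rows s v) ` {c. generic d n (flip_rows s v) c \<and> (\<forall>i<d. c i \<ge> 0)}"
  have "chambers d n v \<subseteq> (\<Union>s\<in>Pow {..<d}. ?Q s)"
  proof
    fix P assume "P \<in> chambers d n v"
    then obtain c where c: "generic d n v c" "P = pos_set d n v c" by (auto simp: chambers_def)
    \<comment> \<open>Flipping exactly these rows and replacing \<open>c\<close> by its absolute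
      value leaves every product \<open>c i * v i j\<close> unchanged.\<close>
    define s where "s = {i. i < d \<and> c i < 0}"
    have eq: "functional d (flip_rows s v) (\<lambda>i. \<bar>c i\<bar>) = functional d v c"
      unfolding functional_def by (intro ext sum.cong) (auto simp: flip_rows_def s_def)
    have "generic d n (flip_rows s v) (\<lambda>i. \<bar>c i\<bar>)" "P = pos_set d n (flip_rows s v) (\<lambda>i. \<bar>c i\<bar>)"
      using c by (simp_all add: generic_def pos_set_def eq)
    then have "P \<in> ?Q s" by (intro image_eqI[where x = "\<lambda>i. \<bar>c i\<bar>"]) auto
    moreover have "s \<in> Pow {..<d}" by (auto simp: s_def)
    ultimately show "P \<in> (\<Union>s\<in>Pow {..<d}. ?Q s)" by blast
  qed
  moreover have "finite (?Q s)" for s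
    by (rule finite_subset[of _ "Pow {..<n}"]) (auto simp: pos_set_def)
  ultimately have "card (chambers d n v) \<le> card (\<Union>s\<in>Pow {..<d}. ?Q s)"
    by (intro card_mono) auto
  also have "\<dots> \<le> (\<Sum>s\<in>Pow {..<d}. card (?Q s))" by (rule card_UN_le) simp
  also have "\<dots> \<le> (\<Sum>s\<in>Pow {..<d}. num_pareto d (cube_image d n (flip_rows s v)))"
    by (intro sum_mono card_nonneg_chambers_le)
  finally show ?thesis .
qed

section \<open>Almost sure general position\<close>

lemma borel_measurable_det:
  fixes f :: "nat \<Rightarrow> nat \<Rightarrow> 'b \<Rightarrow> real"
  assumes "\<And>i j. i < m \<Longrightarrow> j < m \<Longrightarrow> f i j \<in> borel_measurable N"
  shows "(\<lambda>x. Determinant.det (Matrix.mat m m (\<lambda>(i, j). f i j x))) \<in> borel_measurable N"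
proof -
  have eq: "Determinant.det (Matrix.mat m m (\<lambda>(i, j). f i j x))
      = (\<Sum>p | p permutes {0..<m}. of_int (sign p) * (\<Prod>i = 0..<m. f i (p i) x))" for x
    unfolding Determinant.det_def
    by (auto intro!: sum.cong prod.cong simp: permutes_in_image)
  show ?thesis
    unfolding eq
    by (intro borel_measurable_sum borel_measurable_times borel_measurable_prod assms)
       (auto simp: permutes_in_image)
qed

text \<open>Expansion along the last column: the two large matrices differ only in the corner, and
  the cofactors of that column do not see its entries. This isolates one random entry for the
  induction on minors.\<close>

lemma det_affine_in_corner:
  fixes a :: "nat \<Rightarrow> nat \<Rightarrow> real"
  shows "Determinant.det (Matrix.mat (Suc m) (Suc m) (\<lambda>(i, j). a i j))
    = a m m * Determinant.det (Matrix.mat m m (\<lambda>(i, j). a i j))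
      + Determinant.det (Matrix.mat (Suc m) (Suc m) (\<lambda>(i, j). if i = m \<and> j = m then 0 else a i j))"
proof -
  let ?A = "Matrix.mat (Suc m) (Suc m) (\<lambda>(i, j). a i j)"
  let ?B = "Matrix.mat (Suc m) (Suc m) (\<lambda>(i, j). if i = m \<and> j = m then 0 else a i j)"
  have cof: "cofactor ?B i m = cofactor ?A i m" if "i < Suc m" for i
    unfolding cofactor_def
    by (intro arg_cong2[where f = "(*)"] arg_cong[where f = Determinant.det] refl)
       (auto simp: mat_delete_def)
  have corner: "cofactor ?A m m = Determinant.det (Matrix.mat m m (\<lambda>(i, j). a i j))"
    unfolding cofactor_def mat_delete_def
    by (auto intro!: arg_cong[where f = Determinant.det])
  have "Determinant.det ?A = (\<Sum>i<Suc m. ?A $$ (i, m) * cofactor ?A i m)"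
    by (rule laplace_expansion_column) auto
  moreover have "Determinant.det ?B = (\<Sum>i<Suc m. ?B $$ (i, m) * cofactor ?B i m)"
    by (rule laplace_expansion_column) auto
  ultimately show ?thesis by (simp add: cof corner)
qed

section \<open>From nonzero minors to general position\<close>

lemma solvable_if_det_nonzero:
  fixes A :: "real Matrix.mat"
  assumes A: "A \<in> carrier_mat m m" and det: "Determinant.det A \<noteq> 0" and y: "y \<in> carrier_vec m"
  obtains c where "c \<in> carrier_vec m" "A *\<^sub>v c = y"
proof -
  from det_non_zero_imp_unit[OF A det, of "()"]
  obtain B where "A * B = 1\<^sub>m m" and B: "B \<in> carrier_mat m m"
    unfolding Units_def ring_mat_def by auto
  then have "A *\<^sub>v (B *\<^sub>v y) = y"
    using A B y by (metis assoc_mult_mat_vec one_mult_mat_vec)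
  then show thesis using that B y by (meson mult_mat_vec_carrier)
qed

lemma kernel_trivial_if_det_nonzero:
  fixes A :: "real Matrix.mat"
  assumes "A \<in> carrier_mat m m" "Determinant.det A \<noteq> 0" "c \<in> carrier_vec m" "A *\<^sub>v c = 0\<^sub>v m"
  shows "c = 0\<^sub>v m"
  using assms det_0_iff_vec_prod_zero_field by blast

text \<open>Enumerating \<open>T\<close> by \<open>t\<close>, the transposed minor maps the first
  \<open>min d n\<close> coefficients of a functional to its values on \<open>T\<close>.
  Invertibility of this map gives both solvability and uniqueness.\<close>

lemma general_positionI:
  assumes det: "\<And>t. inj_on t {..<min d n} \<Longrightarrow> t ` {..<min d n} \<subseteq> {..<n} \<Longrightarrow>
    Determinant.det (Matrix.mat (min d n) (min d n) (\<lambda>(i, j). v i (t j))) \<noteq> 0"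
  shows "general_position d n v"
  unfolding general_position_def
proof (intro allI impI)
  fix T assume T: "T \<subseteq> {..<n}" "card T = min d n"
  define m where "m = min d n"
  have "finite T" using T(1) finite_subset by blast
  then obtain t where t: "bij_betw t {..<m} T"
    using T(2) ex_bij_betw_nat_finite[of T] by (auto simp: m_def atLeast0LessThan)
  let ?M = "Matrix.mat m m (\<lambda>(i, j). v i (t j))"
  let ?A = "transpose_mat ?M"
  have A: "?A \<in> carrier_mat m m" by simp
  have "Determinant.det ?M \<noteq> 0"
    unfolding m_def by (rule det) (use t T in \<open>auto simp: bij_betw_def m_def\<close>)
  then have detA: "Determinant.det ?A \<noteq> 0" by (subst det_transpose[of _ m]) auto
  have eval: "(?A *\<^sub>v Matrix.vec m c) $ k = functional d v c (t k)"
    \<comment> \<open>Coefficients vanishing from \<open>m\<close> on cut the sum over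
      \<open>d\<close> rows down to the \<open>m\<close> rows of the minor.\<close>
    if "k < m" "\<forall>i\<ge>m. c i = 0" for c k
  proof -
    have "functional d v c (t k) = (\<Sum>i<m. c i * v i (t k))"
      unfolding functional_def by (rule sum.mono_neutral_right) (use that in \<open>auto simp: m_def\<close>)
    then show ?thesis
      using that by (simp add: scalar_prod_def atLeast0LessThan mult.commute)
  qed
  show "(\<forall>y. \<exists>c. (\<forall>i\<ge>min d n. c i = 0) \<and> (\<forall>j\<in>T. functional d v c j = y j)) \<and>
        (\<forall>c. (\<forall>i\<ge>min d n. c i = 0) \<and> (\<forall>j\<in>T. functional d v c j = 0) \<longrightarrow> (\<forall>i. c i = 0))"
    unfolding m_def[symmetric]
  proof (intro conjI allI impI)
    fix y
    obtain x where x: "x \<in> carrier_vec m" "?A *\<^sub>v x = Matrix.vec m (\<lambda>k. y (t k))"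
      using solvable_if_det_nonzero[OF A detA, of "Matrix.vec m (\<lambda>k. y (t k))"] by auto
    define c where "c = (\<lambda>i. if i < m then x $ i else 0)"
    have xc: "x = Matrix.vec m c" using x(1) by (auto simp: c_def)
    have "functional d v c (t k) = y (t k)" if "k < m" for k
    proof -
      have "functional d v c (t k) = (?A *\<^sub>v Matrix.vec m c) $ k"
        by (rule eval[symmetric]) (use that in \<open>auto simp: c_def\<close>)
      also have "\<dots> = y (t k)" using x(2) that unfolding xc by simp
      finally show ?thesis .
    qed
    then have "\<forall>j\<in>T. functional d v c j = y j" using t by (auto simp: bij_betw_def)
    then show "\<exists>c. (\<forall>i\<ge>m. c i = 0) \<and> (\<forall>j\<in>T. functional d v c j = y j)"
      by (intro exI[of _ c]) (auto simp: c_def)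
  next
    fix c i assume c: "(\<forall>i\<ge>m. c i = 0) \<and> (\<forall>j\<in>T. functional d v c j = 0)"
    have "(?A *\<^sub>v Matrix.vec m c) $ k = 0" if "k < m" for k
      using eval[OF that] c t that by (auto simp: bij_betw_def)
    then have "?A *\<^sub>v Matrix.vec m c = 0\<^sub>v m" by (intro eq_vecI) auto
    then have z: "Matrix.vec m c = 0\<^sub>v m"
      by (rule kernel_trivial_if_det_nonzero[OF A detA, rotated]) simp
    show "c i = 0"
    proof (cases "i < m")
      case True
      then have "c i = Matrix.vec m c $ i" by simp
      also have "\<dots> = 0" unfolding z using True by simp
      finally show ?thesis .
    qed (use c in simp)
  qed
qed

section \<open>Almost sure nonvanishing of random minors\<close>

text \<open>For fixed \<open>z\<close> with \<open>D z\<close> nonzero, the affine function has a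
  single root, a null set for the law of \<open>g (Y \<omega>)\<close> because that law has a
  density. By independence the joint law is a product, so the null sections combine.\<close>

lemma (in prob_space) AE_affine_nonzero:
  fixes g D R :: "'b \<Rightarrow> real"
  assumes ind: "indep_var N Z L Y" and X: "distributed M lborel (\<lambda>\<omega>. g (Y \<omega>)) f"
    and [measurable]: "g \<in> borel_measurable L" "D \<in> borel_measurable N" "R \<in> borel_measurable N"
    and nz: "AE \<omega> in M. D (Z \<omega>) \<noteq> 0"
  shows "AE \<omega> in M. g (Y \<omega>) * D (Z \<omega>) + R (Z \<omega>) \<noteq> 0"
proof -
  have [measurable]: "Z \<in> measurable M N" "Y \<in> measurable M L"
    using indep_var_rv1[OF ind] indep_var_rv2[OF ind] by auto
  interpret Z: prob_space "distr M N Z" by (rule prob_space_distr) simp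
  interpret Y: prob_space "distr M L Y" by (rule prob_space_distr) simp
  interpret P: pair_prob_space "distr M N Z" "distr M L Y" ..
  have "AE z in distr M N Z. D z \<noteq> 0" using nz by (subst AE_distr_iff) auto
  then have "AE z in distr M N Z. AE y in distr M L Y. g y * D z + R z \<noteq> 0"
  proof eventually_elim
    case (elim z)
    have "AE x in lborel. x \<noteq> - R z / D z" by (rule AE_lborel_singleton)
    then have "AE x in lborel. 0 < f x \<longrightarrow> x * D z + R z \<noteq> 0"
      by eventually_elim (use elim in \<open>auto simp: field_simps add_eq_0_iff\<close>)
    then have "AE x in density lborel f. x * D z + R z \<noteq> 0"
      using distributed_borel_measurable[OF X] by (subst AE_density) auto
    then have "AE \<omega> in M. g (Y \<omega>) * D z + R z \<noteq> 0"
      unfolding distributed_distr_eq_density[OF X, symmetric] by (subst (asm) AE_distr_iff) auto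
    then show "AE y in distr M L Y. g y * D z + R z \<noteq> 0"
      by (subst AE_distr_iff) auto
  qed
  moreover have "{p \<in> space (N \<Otimes>\<^sub>M L). g (snd p) * D (fst p) + R (fst p) \<noteq> 0} \<in> sets (N \<Otimes>\<^sub>M L)"
    by measurable
  ultimately have "AE p in distr M N Z \<Otimes>\<^sub>M distr M L Y. g (snd p) * D (fst p) + R (fst p) \<noteq> 0"
    by (intro P.AE_pair_measure) (simp_all add: space_pair_measure)
  moreover have "distr M N Z \<Otimes>\<^sub>M distr M L Y = distr M (N \<Otimes>\<^sub>M L) (\<lambda>\<omega>. (Z \<omega>, Y \<omega>))"
    using ind unfolding indep_var_distribution_eq by blast
  ultimately have "AE p in distr M (N \<Otimes>\<^sub>M L) (\<lambda>\<omega>. (Z \<omega>, Y \<omega>)). g (snd p) * D (fst p) + R (fst p) \<noteq> 0"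
    by (simp only:)
  then show ?thesis by (subst (asm) AE_distr_iff) auto
qed

text \<open>Induction on the size of the minor. The determinant is affine in its corner entry, with
  the smaller minor as slope; the corner is independent of the other entries, and the slope is
  almost surely nonzero by induction.\<close>

lemma (in prob_space) AE_det_nonzero:
  fixes V :: "nat \<Rightarrow> nat \<Rightarrow> 'a \<Rightarrow> real"
  assumes ind: "indep_vars (\<lambda>_. borel) (\<lambda>(i, j). V i j) ({..<d} \<times> {..<n})"
    and dens: "\<And>i j. i < d \<Longrightarrow> j < n \<Longrightarrow> distributed M lborel (V i j) (f i j)"
    and t: "inj_on t {..<m}" "t ` {..<m} \<subseteq> {..<n}" "m \<le> d"
  shows "AE \<omega> in M. Determinant.det (Matrix.mat m m (\<lambda>(i, j). V i (t j) \<omega>)) \<noteq> 0"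
  using t
proof (induction m)
  case 0
  then show ?case by simp
next
  case (Suc m)
  let ?I = "{..<d} \<times> {..<n}"
  \<comment> \<open>All entries of the minor except its corner, so that \<open>Z\<close> determines
    both the slope and the remainder.\<close>
  define K where "K = {..<Suc m} \<times> t ` {..<Suc m} - {(m, t m)}"
  define Z where "Z = (\<lambda>\<omega>. restrict (\<lambda>k. (case k of (i, j) \<Rightarrow> V i j) \<omega>) K)"
  have tm: "t m < n" using Suc.prems by auto
  have tj: "t j \<noteq> t m" if "j < m" for j
    using Suc.prems(1) that by (auto simp: inj_on_def)
  have Kin: "(i, t j) \<in> K" if "i < Suc m" "j < Suc m" "(i, j) \<noteq> (m, m)" for i j
    using that tj[of j] by (cases "j = m") (auto simp: K_def)
  \<comment> \<open>Restricting an independent family yields function-valued variables, so the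
    corner entry is carried on a singleton index set and read off by evaluation.\<close>
  define Y where "Y = (\<lambda>\<omega>. restrict (\<lambda>k. (case k of (i, j) \<Rightarrow> V i j) \<omega>) {(m, t m)})"
  have indZ: "indep_var (PiM K (\<lambda>_. borel)) Z (PiM {(m, t m)} (\<lambda>_. borel)) Y"
    unfolding Z_def Y_def
    by (rule indep_var_restrict[OF ind]) (use Suc.prems tm in \<open>auto simp: K_def\<close>)
  have Yk: "Y \<omega> (m, t m) = V m (t m) \<omega>" for \<omega> by (simp add: Y_def)
  define D where "D = (\<lambda>z. Determinant.det (Matrix.mat m m (\<lambda>(i, j). (z (i, t j) :: real))))"
  define R where "R = (\<lambda>z. Determinant.det (Matrix.mat (Suc m) (Suc m)
    (\<lambda>(i, j). if i = m \<and> j = m then 0 else (z (i, t j) :: real))))"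
  have ZV: "Z \<omega> (i, t j) = V i (t j) \<omega>" if "i < Suc m" "j < Suc m" "(i, j) \<noteq> (m, m)" for i j \<omega>
    using Kin[OF that] by (simp add: Z_def)
  have DZ: "D (Z \<omega>) = Determinant.det (Matrix.mat m m (\<lambda>(i, j). V i (t j) \<omega>))" for \<omega>
    unfolding D_def by (intro arg_cong[where f = Determinant.det]) (auto simp: ZV)
  have RZ: "R (Z \<omega>) = Determinant.det (Matrix.mat (Suc m) (Suc m)
      (\<lambda>(i, j). if i = m \<and> j = m then 0 else V i (t j) \<omega>))" for \<omega>
    unfolding R_def by (intro arg_cong[where f = Determinant.det]) (auto simp: ZV)
  have meas: "(\<lambda>z. z (i, t j)) \<in> borel_measurable (PiM K (\<lambda>_. borel))"
    if "i < Suc m" "j < Suc m" "(i, j) \<noteq> (m, m)" for i j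
    using Kin[OF that] by (rule measurable_component_singleton)
  have D: "D \<in> borel_measurable (PiM K (\<lambda>_. borel))"
    unfolding D_def by (rule borel_measurable_det) (auto intro!: meas)
  have R: "R \<in> borel_measurable (PiM K (\<lambda>_. borel))"
    unfolding R_def
  proof (rule borel_measurable_det)
    fix i j assume "i < Suc m" "j < Suc m"
    then show "(\<lambda>z. if i = m \<and> j = m then 0 else z (i, t j)) \<in> borel_measurable (PiM K (\<lambda>_. borel))"
      using meas[of i j] by (cases "i = m \<and> j = m") auto
  qed
  have "AE \<omega> in M. D (Z \<omega>) \<noteq> 0"
    unfolding DZ using Suc.prems by (intro Suc.IH) (auto simp: image_subset_iff intro: inj_on_subset)
  moreover have "distributed M lborel (\<lambda>\<omega>. Y \<omega> (m, t m)) (f m (t m))"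
    unfolding Yk using dens tm Suc.prems by auto
  ultimately have "AE \<omega> in M. Y \<omega> (m, t m) * D (Z \<omega>) + R (Z \<omega>) \<noteq> 0"
    by (intro AE_affine_nonzero[OF indZ _ _ D R]) auto
  then show ?case
    unfolding DZ RZ Yk by (subst det_affine_in_corner)
qed

lemma (in prob_space) AE_general_position:
  fixes V :: "nat \<Rightarrow> nat \<Rightarrow> 'a \<Rightarrow> real"
  assumes ind: "indep_vars (\<lambda>_. borel) (\<lambda>(i, j). V i j) ({..<d} \<times> {..<n})"
    and dens: "\<And>i j. i < d \<Longrightarrow> j < n \<Longrightarrow> distributed M lborel (V i j) (f i j)"
  shows "AE \<omega> in M. general_position d n (\<lambda>i j. V i j \<omega>)"
proof -
  define m where "m = min d n"
  \<comment> \<open>Extensional functions keep the set of enumerations finite, so finitely many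
    almost sure events are intersected.\<close>
  define Ts where "Ts = {t \<in> {..<m} \<rightarrow>\<^sub>E {..<n}. inj_on t {..<m}}"
  have "finite Ts" unfolding Ts_def by (auto intro!: finite_PiE)
  then have "AE \<omega> in M. \<forall>t\<in>Ts. Determinant.det (Matrix.mat m m (\<lambda>(i, j). V i (t j) \<omega>)) \<noteq> 0"
  proof (rule AE_finite_allI)
    fix t assume "t \<in> Ts"
    then have "inj_on t {..<m}" "t ` {..<m} \<subseteq> {..<n}" by (auto simp: Ts_def PiE_iff)
    then show "AE \<omega> in M. Determinant.det (Matrix.mat m m (\<lambda>(i, j). V i (t j) \<omega>)) \<noteq> 0"
      by (intro AE_det_nonzero[OF ind dens]) (simp_all add: m_def)
  qed
  then show ?thesis
  proof eventually_elim
    case (elim \<omega>)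
    show "general_position d n (\<lambda>i j. V i j \<omega>)"
    proof (rule general_positionI, unfold m_def[symmetric])
      fix t assume t: "inj_on t {..<m}" "t ` {..<m} \<subseteq> {..<n}"
      have "restrict t {..<m} \<in> Ts" using t by (auto simp: Ts_def PiE_iff image_subset_iff)
      then have "Determinant.det (Matrix.mat m m (\<lambda>(i, j). V i (restrict t {..<m} j) \<omega>)) \<noteq> 0"
        using elim by blast
      also have "Matrix.mat m m (\<lambda>(i, j). V i (restrict t {..<m} j) \<omega>)
          = Matrix.mat m m (\<lambda>(i, j). V i (t j) \<omega>)"
        by auto
      finally show "Determinant.det (Matrix.mat m m (\<lambda>(i, j). V i (t j) \<omega>)) \<noteq> 0" .
    qed
  qed
qed

section \<open>Invariance of the expected Pareto count under row flips\<close>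

text \<open>Each fibre of \<open>g\<close> over \<open>A\<close> has exactly one element of least
  rank. Counting these turns the size of an image into a count of indices satisfying a
  condition.\<close>

lemma card_image_eq_card_least_representatives:
  fixes r :: "'b \<Rightarrow> nat"
  assumes "finite A" "inj_on r A"
  shows "card (g ` A) = card {a \<in> A. \<forall>b\<in>A. r b < r a \<longrightarrow> g b \<noteq> g a}"
proof -
  let ?L = "{a \<in> A. \<forall>b\<in>A. r b < r a \<longrightarrow> g b \<noteq> g a}"
  have "inj_on g ?L"
    by (rule inj_onI) (use assms(2) in \<open>auto simp: inj_on_def, metis linorder_neqE_nat\<close>)
  moreover have "g ` ?L = g ` A"
  proof
    show "g ` A \<subseteq> g ` ?L"
    proof
      fix x assume "x \<in> g ` A"
      then have "\<exists>a. a \<in> A \<and> g a = x" by auto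
      from ex_has_least_nat[of "\<lambda>a. a \<in> A \<and> g a = x" _ r] this
      obtain a where "a \<in> A" "g a = x" "\<And>b. b \<in> A \<Longrightarrow> g b = x \<Longrightarrow> r a \<le> r b" by blast
      then show "x \<in> g ` ?L" by (intro image_eqI[where x = a]) force+
    qed
  qed auto
  ultimately show ?thesis using card_image[of g ?L] by simp
qed

text \<open>Distinct vertices of the cube may have the same image, so the measurable sum below counts each
  point once, at the vertex of least rank \<open>r\<close>.\<close>

lemma borel_measurable_num_pareto:
  assumes [measurable]: "\<And>i j. i < d \<Longrightarrow> j < n \<Longrightarrow> (\<lambda>x. W x i j) \<in> borel_measurable N"
  shows "(\<lambda>x. real (num_pareto d (cube_image d n (W x)))) \<in> borel_measurable N"
proof -
  let ?A = "Pow {..<n}"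
  obtain r :: "nat set \<Rightarrow> nat" where r: "inj_on r ?A"
    using finite_imp_inj_to_nat_seg[of ?A] by auto
  let ?par = "\<lambda>x S. \<forall>T\<in>?A. \<not> dominates d (cube_point d (W x) T) (cube_point d (W x) S)"
  let ?le = "\<lambda>x S. \<forall>T\<in>?A. r T < r S \<longrightarrow> \<not> (\<forall>i<d. cube_point d (W x) T i = cube_point d (W x) S i)"
  have eq: "real (num_pareto d (cube_image d n (W x))) = (\<Sum>S\<in>?A. if ?par x S \<and> ?le x S then 1 else 0)" for x
  proof -
    let ?g = "cube_point d (W x)"
    have ext: "?g S = ?g T \<longleftrightarrow> (\<forall>i<d. ?g S i = ?g T i)" for S T
      by (auto simp: cube_point_def fun_eq_iff)
    have "{y. pareto_optimal d (cube_image d n (W x)) y} = ?g ` {S\<in>?A. ?par x S}"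
      unfolding pareto_optimal_def cube_image_eq by blast
    then have "num_pareto d (cube_image d n (W x)) = card (?g ` {S\<in>?A. ?par x S})"
      by (simp add: num_pareto_def)
    also have "\<dots> = card {S \<in> {S\<in>?A. ?par x S}. \<forall>T\<in>{S\<in>?A. ?par x S}. r T < r S \<longrightarrow> ?g T \<noteq> ?g S}"
      by (rule card_image_eq_card_least_representatives) (auto intro: inj_on_subset[OF r])
    also have "{S \<in> {S\<in>?A. ?par x S}. \<forall>T\<in>{S\<in>?A. ?par x S}. r T < r S \<longrightarrow> ?g T \<noteq> ?g S}
        = {S \<in> ?A. ?par x S \<and> ?le x S}"
    proof -
      \<comment> \<open>Optimality depends only on the image point, so a vertex of smaller rank with
        the same image is itself optimal; comparing with all vertices or only with optimal ones is
        the same.\<close>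
      have "?par x T" if "?par x S" "?g T = ?g S" for S T using that by simp
      then show ?thesis unfolding ext[symmetric] by blast
    qed
    finally show ?thesis by (simp add: sum.If_cases Int_def)
  qed
  have [measurable]: "(\<lambda>x. cube_point d (W x) S i) \<in> borel_measurable N" if "S \<in> ?A" "i < d" for S i
    using that unfolding cube_point_def by (auto intro!: borel_measurable_sum assms)
  have [measurable]: "Measurable.pred N (\<lambda>x. ?par x S)" if "S \<in> ?A" for S
    unfolding dominates_def
    by (intro pred_intros_logic pred_intros_finite pred_intros_countable_bounded)
       (use that in \<open>auto intro!: borel_measurable_le borel_measurable_less simp: pred_def\<close>)
  have [measurable]: "Measurable.pred N (\<lambda>x. ?le x S)" if "S \<in> ?A" for S
    by (intro pred_intros_logic pred_intros_finite pred_intros_countable_bounded)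
       (use that in \<open>auto intro!: borel_measurable_eq simp: pred_def\<close>)
  show ?thesis
    unfolding eq by (intro borel_measurable_sum) measurable
qed

section \<open>Sign changes and the joint law\<close>

lemma distr_uminus_symmetric_density:
  fixes X :: "'a \<Rightarrow> real"
  assumes X: "distributed M lborel X f" and sym: "\<And>x. f (- x) = f x"
  shows "distr M borel (\<lambda>\<omega>. - X \<omega>) = distr M borel X"
proof -
  have [measurable]: "X \<in> borel_measurable M" "f \<in> borel_measurable borel"
    using distributed_measurable[OF X] distributed_borel_measurable[OF X] by auto
  have dX: "distr M borel X = density lborel f"
  proof -
    have "distr M borel X = distr M lborel X" by (rule distr_cong) auto
    then show ?thesis using distributed_distr_eq_density[OF X] by simp
  qed
  have "distr M borel (\<lambda>\<omega>. - X \<omega>) = distr (distr M borel X) borel uminus"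
    by (subst distr_distr) (auto simp: comp_def)
  \<comment> \<open>Evenness puts the density in the form of a pullback along negation, which can be
    moved outside the pushforward; Lebesgue measure is invariant under negation.\<close>
  also have "\<dots> = distr (density lborel (\<lambda>x. f (- x))) borel uminus"
    unfolding dX sym ..
  also have "\<dots> = density (distr lborel borel uminus) f"
    by (rule density_distr[symmetric]) auto
  also have "\<dots> = distr M borel X" unfolding dX lborel_distr_uminus ..
  finally show ?thesis .
qed

text \<open>The flipped entries are again independent with the same marginals, so the joint law, a
  product of marginals, is unchanged. The Pareto count is a measurable function of the joint
  entries.\<close>

lemma (in prob_space) expectation_num_pareto_flip:
  fixes V :: "nat \<Rightarrow> nat \<Rightarrow> 'a \<Rightarrow> real"
  assumes ind: "indep_vars (\<lambda>_. borel) (\<lambda>(i, j). V i j) ({..<d} \<times> {..<n})"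
    and dens: "\<And>i j. i < d \<Longrightarrow> j < n \<Longrightarrow> distributed M lborel (V i j) (f i j)"
    and sym: "\<And>i j x. i < d \<Longrightarrow> j < n \<Longrightarrow> f i j (- x) = f i j x"
    and "d \<ge> 1" "n \<ge> 1"
  shows "expectation (\<lambda>\<omega>. real (num_pareto d (cube_image d n (flip_rows s (\<lambda>i j. V i j \<omega>)))))
       = expectation (\<lambda>\<omega>. real (num_pareto d (cube_image d n (\<lambda>i j. V i j \<omega>))))"
proof -
  let ?I = "{..<d} \<times> {..<n}"
  let ?N = "PiM ?I (\<lambda>_. borel :: real measure)"
  define X where "X = (\<lambda>(i, j). V i j)"
  define Y where "Y = (\<lambda>k \<omega>. if fst k \<in> s then - X k \<omega> else X k \<omega>)"
  define h where "h = (\<lambda>z::nat \<times> nat \<Rightarrow> real. real (num_pareto d (cube_image d n (\<lambda>i j. z (i, j)))))"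
  have ne: "?I \<noteq> {}" using assms(4,5) by (auto simp: lessThan_empty_iff)
  have indX: "indep_vars (\<lambda>_. borel) X ?I" using ind unfolding X_def .
  have indY: "indep_vars (\<lambda>_. borel) Y ?I"
    using indep_vars_compose2[OF indX, of "\<lambda>k x. if fst k \<in> s then - x else x" "\<lambda>_. borel"]
    unfolding Y_def by auto
  have rvX: "random_variable borel (X k)" and rvY: "random_variable borel (Y k)" if "k \<in> ?I" for k
    using indX indY that by (auto simp: indep_vars_def2)
  have marg: "distr M borel (Y k) = distr M borel (X k)" if k: "k \<in> ?I" for k
  proof (cases "fst k \<in> s")
    case True
    obtain i j where ij: "k = (i, j)" "i < d" "j < n" using k by auto
    have "distr M borel (\<lambda>\<omega>. - V i j \<omega>) = distr M borel (V i j)"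
      by (rule distr_uminus_symmetric_density[OF dens]) (use ij sym in auto)
    then show ?thesis using True by (simp add: Y_def X_def ij(1))
  qed (simp add: Y_def)
  have joint: "distr M ?N (\<lambda>\<omega>. \<lambda>k\<in>?I. Y k \<omega>) = distr M ?N (\<lambda>\<omega>. \<lambda>k\<in>?I. X k \<omega>)"
  proof -
    have "distr M ?N (\<lambda>\<omega>. \<lambda>k\<in>?I. Y k \<omega>) = PiM ?I (\<lambda>k. distr M borel (Y k))"
      by (rule indep_vars_iff_distr_eq_PiM'[OF ne rvY, THEN iffD1, OF _ indY])
    also have "\<dots> = PiM ?I (\<lambda>k. distr M borel (X k))"
      by (rule PiM_cong) (auto simp: marg)
    also have "\<dots> = distr M ?N (\<lambda>\<omega>. \<lambda>k\<in>?I. X k \<omega>)"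
      by (rule indep_vars_iff_distr_eq_PiM'[OF ne rvX, THEN iffD1, OF _ indX, symmetric])
    finally show ?thesis .
  qed
  have h: "h \<in> borel_measurable ?N"
    unfolding h_def
    by (rule borel_measurable_num_pareto) (auto intro!: measurable_component_singleton)
  \<comment> \<open>Restricted families are undefined outside the index set, so \<open>h\<close>
    must depend only on the entries inside it.\<close>
  have cong: "cube_image d n v = cube_image d n w" if "\<And>i j. i < d \<Longrightarrow> j < n \<Longrightarrow> v i j = w i j" for v w
    unfolding cube_image_def by (intro image_cong ext) (auto intro!: sum.cong that)
  have hX: "h (\<lambda>k\<in>?I. X k \<omega>) = real (num_pareto d (cube_image d n (\<lambda>i j. V i j \<omega>)))" for \<omega>
    unfolding h_def by (intro arg_cong[where f = "\<lambda>S. real (num_pareto d S)"] cong) (auto simp: X_def)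
  have hY: "h (\<lambda>k\<in>?I. Y k \<omega>) = real (num_pareto d (cube_image d n (flip_rows s (\<lambda>i j. V i j \<omega>))))" for \<omega>
    unfolding h_def
    by (intro arg_cong[where f = "\<lambda>S. real (num_pareto d S)"] cong) (auto simp: X_def Y_def flip_rows_def)
  have "expectation (\<lambda>\<omega>. h (\<lambda>k\<in>?I. Y k \<omega>)) = integral\<^sup>L (distr M ?N (\<lambda>\<omega>. \<lambda>k\<in>?I. Y k \<omega>)) h"
    by (rule integral_distr[OF measurable_restrict[OF rvY] h, symmetric])
  also have "\<dots> = expectation (\<lambda>\<omega>. h (\<lambda>k\<in>?I. X k \<omega>))"
    unfolding joint by (rule integral_distr[OF measurable_restrict[OF rvX] h])
  finally show ?thesis unfolding hX hY .
qed

section \<open>Averaging the chamber bound over all row flips\<close>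

lemma num_pareto_cube_image_le: "num_pareto d (cube_image d n v) \<le> 2 ^ n"
proof -
  have "num_pareto d (cube_image d n v) \<le> card (cube_image d n v)"
    unfolding num_pareto_def
    by (rule card_mono) (auto simp: pareto_optimal_def cube_image_eq)
  also have "\<dots> \<le> card (Pow {..<n})" unfolding cube_image_eq by (rule card_image_le) simp
  finally show ?thesis by (simp add: card_Pow)
qed

theorem theorem1:
  fixes M :: "'a measure" and V :: "nat \<Rightarrow> nat \<Rightarrow> 'a \<Rightarrow> real"
    and f :: "nat \<Rightarrow> nat \<Rightarrow> real \<Rightarrow> real" and d n :: nat
  assumes "prob_space M" and "d \<ge> 1" and "n \<ge> 1"
    and "prob_space.indep_vars M (\<lambda>_. borel) (\<lambda>(i, j). V i j) ({..<d} \<times> {..<n})"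
    and "\<And>i j. i < d \<Longrightarrow> j < n \<Longrightarrow> distributed M lborel (V i j) (\<lambda>x. ennreal (f i j x))"
    and "\<And>i j x. i < d \<Longrightarrow> j < n \<Longrightarrow> f i j (- x) = f i j x"
  shows "prob_space.expectation M (\<lambda>\<omega>. real (num_pareto d (cube_image d n (\<lambda>i j. V i j \<omega>))))
           \<ge> (1 / 2 ^ (d - 1)) * (\<Sum>k = 0..d - 1. real ((n - 1) choose k))"
proof -
  interpret prob_space M by fact
  let ?p = "\<lambda>s \<omega>. real (num_pareto d (cube_image d n (flip_rows s (\<lambda>i j. V i j \<omega>))))"
  let ?E = "expectation (\<lambda>\<omega>. real (num_pareto d (cube_image d n (\<lambda>i j. V i j \<omega>))))"
  let ?B = "\<Sum>k = 0..d - 1. real ((n - 1) choose k)"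
  have [measurable]: "V i j \<in> borel_measurable M" if "i < d" "j < n" for i j
    using distributed_measurable[OF assms(5)[OF that]] by simp
  have int: "integrable M (?p s)" for s
  proof (rule integrable_const_bound[where B = "2 ^ n"])
    have "?p s \<omega> \<le> 2 ^ n" for \<omega>
      using of_nat_mono[OF num_pareto_cube_image_le, where 'a = real] by simp
    then show "AE \<omega> in M. norm (?p s \<omega>) \<le> 2 ^ n" by simp
    show "?p s \<in> borel_measurable M"
      by (rule borel_measurable_num_pareto) (auto simp: flip_rows_def)
  qed
  have "AE \<omega> in M. general_position d n (\<lambda>i j. V i j \<omega>)"
    by (rule AE_general_position[OF assms(4,5)])
  then have ae: "AE \<omega> in M. 2 * ?B \<le> (\<Sum>s\<in>Pow {..<d}. ?p s \<omega>)"
  proof eventually_elim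
    case (elim \<omega>)
    have "2 * (\<Sum>k=0..d - 1. (n - 1) choose k)
        \<le> (\<Sum>s\<in>Pow {..<d}. num_pareto d (cube_image d n (flip_rows s (\<lambda>i j. V i j \<omega>))))"
      using card_chambers_ge[OF elim assms(2,3)] card_chambers_le_sum_num_pareto by (rule order_trans)
    then have "real (2 * (\<Sum>k=0..d - 1. (n - 1) choose k))
        \<le> real (\<Sum>s\<in>Pow {..<d}. num_pareto d (cube_image d n (flip_rows s (\<lambda>i j. V i j \<omega>))))"
      by (simp only: of_nat_le_iff)
    then show ?case by simp
  qed
  have "2 * ?B = expectation (\<lambda>_. 2 * ?B)" by (simp add: prob_space)
  also have "\<dots> \<le> expectation (\<lambda>\<omega>. \<Sum>s\<in>Pow {..<d}. ?p s \<omega>)"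
    using ae by (intro integral_mono_AE) (auto intro!: integrable_sum int)
  also have "\<dots> = (\<Sum>s\<in>Pow {..<d}. expectation (?p s))"
    by (rule Bochner_Integration.integral_sum) (rule int)
  also have "\<dots> = (\<Sum>s\<in>Pow {..<d}. ?E)"
    using expectation_num_pareto_flip[OF assms(4,5)] assms(2,3,6) by simp
  also have "\<dots> = 2 ^ d * ?E" by (simp add: card_Pow)
  \<comment> \<open>One factor 2 cancels against the doubling from opposite functionals, which
    leaves the exponent \<open>d - 1\<close>.\<close>
  also have "(2::real) ^ d = 2 * 2 ^ (d - 1)" using assms(2) by (cases d) auto
  finally show ?thesis by (simp add: field_simps)
qed

end
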